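(* Define the focal loss with hyperparameter $\gamma\ge0$ via the partial losses $\ell_1^{\mathrm{FL}}(u)=-(1-u)^\gamma\log u$ and $\ell_{-1}^{\mathrm{FL}}(u)=\ell_1^{\mathrm{FL}}(1-u)$. Then the focal loss is not twist-proper.
   Context: A class probability estimation loss with partial losses $\ell_1,\ell_{-1}$ on $[0,1]$ has pointwise conditional risk $L(u,v)=v\,\ell_1(u)+(1-v)\,\ell_{-1}(u)$ and (set-valued) Bayes tilted estimate $t_\ell(v)=\arg\inf_{u\in[0,1]}L(u,v)$. A twist is a general mapping $\eta_c\mapsto\eta_t$ from a clean posterior $\eta_c\in[0,1]$ to a twisted posterior $\eta_t\in[0,1]$. A loss with hyperparameter(s) is twist-proper iff for any twist there exist hyperparameter(s) such that $\eta_c\in t_\ell(\eta_t)$. *)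

theory Defs
  imports Complex_Main "HOL-Library.Extended_Real" "HOL-Library.FuncSet"
begin

text \<open>Partial losses take extended real values, since log-type losses are infinite at an endpoint of
  \<open>[0,1]\<close>. The library's convention \<open>0 * \<infinity> = 0\<close> on \<^typ>\<open>ereal\<close> is the usual one for the
  conditional risk at \<open>v = 0\<close> and \<open>v = 1\<close>.\<close>

definition cond_risk :: "(real \<Rightarrow> ereal) \<Rightarrow> (real \<Rightarrow> ereal) \<Rightarrow> real \<Rightarrow> real \<Rightarrow> ereal" where
  "cond_risk l1 lm1 u v = ereal v * l1 u + ereal (1 - v) * lm1 u"

definition tilted_estimate :: "(real \<Rightarrow> ereal) \<Rightarrow> (real \<Rightarrow> ereal) \<Rightarrow> real \<Rightarrow> real set" where
  "tilted_estimate l1 lm1 v =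
     {u. is_arg_min (\<lambda>u. cond_risk l1 lm1 u v) (\<lambda>u. u \<in> {0..1}) u}"

text \<open>The relation \<open>\<eta>c \<in> t(\<eta>t)\<close> is a pointwise one, so the hyperparameter may be
  chosen as a function of the point: \<open>h \<eta>c\<close> is the value used to undo the twist at \<open>\<eta>c\<close>.
  Constant \<open>h\<close> are included, hence failure of this property also rules out a single
  hyperparameter serving all \<open>\<eta>c\<close>.\<close>

definition twist_proper ::
    "'h set \<Rightarrow> ('h \<Rightarrow> real \<Rightarrow> ereal) \<Rightarrow> ('h \<Rightarrow> real \<Rightarrow> ereal) \<Rightarrow> bool" where
  "twist_proper H l1 lm1 \<longleftrightarrow>
     (\<forall>T \<in> {0..1} \<rightarrow> {0..1}. \<exists>h \<in> {0..1} \<rightarrow> H. \<forall>\<eta>c \<in> {0..1}.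
        \<eta>c \<in> tilted_estimate (l1 (h \<eta>c)) (lm1 (h \<eta>c)) (T \<eta>c))"

text \<open>\<^const>\<open>ln\<close> on the reals satisfies \<open>ln 0 = 0\<close>, so the value \<open>-log 0 = \<infinity>\<close> is set explicitly.\<close>

definition neg_log :: "real \<Rightarrow> ereal" where
  "neg_log u = (if u = 0 then \<infinity> else ereal (- ln u))"

text \<open>The library value \<open>0 powr 0 = 0\<close> is harmless: it only occurs at \<open>u = 1\<close>, where the second
  factor vanishes.\<close>

definition focal_pos :: "real \<Rightarrow> real \<Rightarrow> ereal" where
  "focal_pos \<gamma> u = ereal ((1 - u) powr \<gamma>) * neg_log u"

definition focal_neg :: "real \<Rightarrow> real \<Rightarrow> ereal" where
  "focal_neg \<gamma> u = focal_pos \<gamma> (1 - u)"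

end

theory Submission imports Defs
begin

text \<open>Exchanging \<open>u\<close> and \<open>1 - u\<close> swaps the two partial losses, and the loss of the true label is
  strictly decreasing in the probability assigned to it. So for every \<open>\<gamma>\<close> a Bayes tilted
  estimate lies on the same side of \<open>1/2\<close> as the twisted posterior, and the label-flipping twist
  \<open>\<eta> \<mapsto> 1 - \<eta>\<close> cannot be undone. No degenerate posterior is involved: \<open>\<eta> = 1/4\<close> already fails.\<close>

lemma focal_pos_interior:
  assumes "u \<noteq> 0"
  shows "focal_pos \<gamma> u = ereal ((1 - u) powr \<gamma> * - ln u)"
  using assms by (simp add: focal_pos_def neg_log_def)

text \<open>The power factor decreases weakly (it is constant for \<open>\<gamma> = 0\<close>), so
  strictness comes from the logarithm; \<open>w < 1\<close> keeps the power positive.\<close>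

lemma focal_pos_strict_antimono:
  assumes "0 \<le> \<gamma>" "0 < u" "u < w" "w < 1"
  shows "(1 - w) powr \<gamma> * - ln w < (1 - u) powr \<gamma> * - ln (u::real)"
proof (rule mult_le_less_imp_less)
  show "(1 - w) powr \<gamma> \<le> (1 - u) powr \<gamma>"
    using assms by (intro powr_mono2) auto
  show "- ln w < - ln u" "0 < (1 - w) powr \<gamma>" "0 \<le> - ln w"
    using assms by auto
qed

lemma cond_risk_focal_reflect_less:
  assumes "0 \<le> \<gamma>" "0 < u" "u < 1 / 2" "1 / 2 < v"
  shows "cond_risk (focal_pos \<gamma>) (focal_neg \<gamma>) (1 - u) v
       < cond_risk (focal_pos \<gamma>) (focal_neg \<gamma>) u v"
proof -
  let ?l = "\<lambda>u::real. (1 - u) powr \<gamma> * - ln u"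
  have "?l (1 - u) < ?l u"
    using focal_pos_strict_antimono[of \<gamma> u "1 - u"] assms by simp
  \<comment> \<open>This product is the risk at \<open>u\<close> minus the risk at
    \<open>1 - u\<close>.\<close>
  then have "0 < (2 * v - 1) * (?l u - ?l (1 - u))"
    using assms by (intro mult_pos_pos) auto
  then have "v * ?l (1 - u) + (1 - v) * ?l u < v * ?l u + (1 - v) * ?l (1 - u)"
    by (simp add: algebra_simps)
  moreover have "focal_pos \<gamma> u = ereal (?l u)" "focal_pos \<gamma> (1 - u) = ereal (?l (1 - u))"
    using assms focal_pos_interior[of u \<gamma>] focal_pos_interior[of "1 - u" \<gamma>] by auto
  ultimately show ?thesis
    by (simp add: cond_risk_def focal_neg_def)
qed

theorem lemma6: "\<not> twist_proper {0..} focal_pos focal_neg"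
proof
  assume "twist_proper {0..} focal_pos focal_neg"
  moreover have "(\<lambda>\<eta>. 1 - \<eta>) \<in> {0..1} \<rightarrow> {0..1::real}"
    by auto
  ultimately obtain h where h: "h \<in> {0..1} \<rightarrow> {0..}"
    and tilt: "\<forall>\<eta> \<in> {0..1}. \<eta> \<in> tilted_estimate (focal_pos (h \<eta>)) (focal_neg (h \<eta>)) (1 - \<eta>)"
    unfolding twist_proper_def by blast
  \<comment> \<open>Only the hyperparameter chosen at \<open>1 / 4\<close> matters; any point
    strictly between 0 and 1/2 would serve as well.\<close>
  define \<gamma> where "\<gamma> = h (1 / 4)"
  have "0 \<le> \<gamma>"
    using h by (auto simp: \<gamma>_def Pi_iff)
  then have "cond_risk (focal_pos \<gamma>) (focal_neg \<gamma>) (1 - 1 / 4) (1 - 1 / 4)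
      < cond_risk (focal_pos \<gamma>) (focal_neg \<gamma>) (1 / 4) (1 - 1 / 4)"
    by (intro cond_risk_focal_reflect_less) auto
  moreover have "1 / 4 \<in> tilted_estimate (focal_pos \<gamma>) (focal_neg \<gamma>) (1 - 1 / 4)"
    using tilt unfolding \<gamma>_def by (rule bspec) auto
  moreover have "(1 - 1 / 4 :: real) \<in> {0..1}"
    by auto
  ultimately show False
    unfolding tilted_estimate_def is_arg_min_def by blast
qed

end
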